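(* Let $p(x)=\sum_{i=0}^d x^{d-i}a_i$ and $q(x)=\sum_{i=0}^d x^{d-i}b_i$ be real polynomials of degree $d$ with positive leading coefficients having only nonpositive real roots. Then \[ r(x)=\sum_{k=0}^{d}x^{d-k}\sum_{i+j=k}\left(\frac{(d-i)!\,(d-j)!}{d!\,(d-i-j)!}\right)^2 a_ib_j \] is a polynomial of degree $d$ with positive leading coefficient having only nonpositive real roots. *)

theory Defs
  imports Complex_Main "HOL-Computational_Algebra.Polynomial"
begin

text \<open>All complex zeros are required to be real and nonpositive; quantifying over the real zeros
  alone would not exclude non-real zeros. A nonzero constant satisfies this vacuously.\<close>

definition only_nonpos_real_roots :: "real poly \<Rightarrow> bool" where
  "only_nonpos_real_roots p \<longleftrightarrow>
     (\<forall>z::complex. poly (map_poly complex_of_real p) z = 0 \<longrightarrow> z \<in> \<real> \<and> Re z \<le> 0)"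

end

theory Submission
  imports Defs "HOL-Complex_Analysis.Great_Picard"
    "HOL-Computational_Algebra.Fundamental_Theorem_Algebra"
begin

text \<open>A nonzero real polynomial \<open>p\<close> has only nonpositive real zeros iff \<open>p (x y) \<noteq> 0\<close>
  whenever \<open>Re x > 0\<close> and \<open>Re y > 0\<close>. Consider the linear map sending \<open>y\<^sup>i v\<^sup>j\<close> to
  \<open>i! j! / (d! (i + j - d)!) w\<^bsup>i + j - d\<^esup>\<close>, or to \<open>0\<close> if \<open>i + j < d\<close>. It takes polynomials
  in \<open>y, v\<close> of degree \<open>\<le> d\<close> in each variable, with nonzero coefficient of \<open>y\<^sup>d v\<^sup>d\<close> and
  without zeros in the product of two right half planes, to polynomials in \<open>w\<close> without zeros
  in the right half plane. This two-variable form of Grace's theorem is proved by induction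
  on \<open>d\<close>: polarizing once in each variable (Laguerre) reduces the step to bilinear polynomials.
  Applied to \<open>p (x y) q (u v)\<close> in the pair \<open>x, u\<close> and then in the pair \<open>y, v\<close>, the map
  squares the weights and yields \<open>r\<close> evaluated at a product of two points of the half plane.\<close>

section \<open>Logarithmic and polar derivatives on the right half plane\<close>

text \<open>For \<open>h > 0\<close> the condition on \<open>U\<close> describes the disc of centre
  and radius \<open>n / (2 h)\<close>, and such discs add up as Minkowski sums. At
  \<open>h = 0\<close> the disc for \<open>n = 0\<close> would degenerate to the whole plane, hence
  the last assumption.\<close>

lemma disc_condition_add:
  fixes U u :: complex and h :: real and n :: nat
  assumes U: "h * (cmod U)\<^sup>2 \<le> real n * Re U" and u: "h * (cmod u)\<^sup>2 \<le> Re u"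
    and h: "0 \<le> h" and n: "n = 0 \<longrightarrow> U = 0"
  shows "h * (cmod (U + u))\<^sup>2 \<le> real (Suc n) * Re (U + u)"
proof (cases "n = 0")
  case True
  then show ?thesis using assms by simp
next
  case False
  then have n0: "real n > 0" by simp
  \<comment> \<open>Expanded and divided by \<open>n (n + 1)\<close>, this is the convexity bound
    \<open>|U + u|^2 / (n + 1) \<le> |U|^2 / n + |u|^2\<close>.\<close>
  have "0 \<le> (cmod (U - of_nat n * u))\<^sup>2" by simp
  also have "(cmod (U - of_nat n * u))\<^sup>2
      = (real n + 1) * (cmod U)\<^sup>2 + real n * (real n + 1) * (cmod u)\<^sup>2 - real n * (cmod (U + u))\<^sup>2"
    unfolding cmod_power2 by (simp add: power2_eq_square algebra_simps)
  finally have "h * (real n * (cmod (U + u))\<^sup>2)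
      \<le> h * ((real n + 1) * (cmod U)\<^sup>2 + real n * (real n + 1) * (cmod u)\<^sup>2)"
    using h by (intro mult_left_mono) auto
  also have "\<dots> = (real n + 1) * (h * (cmod U)\<^sup>2) + real n * (real n + 1) * (h * (cmod u)\<^sup>2)"
    by (simp add: algebra_simps)
  also have "\<dots> \<le> (real n + 1) * (real n * Re U) + real n * (real n + 1) * Re u"
    by (intro add_mono mult_left_mono U u) auto
  also have "\<dots> = real n * (real (Suc n) * Re (U + u))"
    by (simp add: algebra_simps)
  finally have "real n * (h * (cmod (U + u))\<^sup>2) \<le> real n * (real (Suc n) * Re (U + u))"
    by (simp add: mult_ac)
  then show ?thesis using n0 by simp
qed

text \<open>Each \<open>u = 1 / (z - a)\<close> with \<open>Re a \<le> 0\<close> lies in the disc \<open>Re z * |u|\<^sup>2 \<le> Re u\<close>; the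
  logarithmic derivative is a sum of \<open>degree f\<close> such numbers.\<close>

lemma log_deriv_in_disc:
  fixes f :: "complex poly"
  assumes "\<And>z. 0 < Re z \<Longrightarrow> poly f z \<noteq> 0" and z: "0 < Re z"
  shows "Re z * (cmod (poly (pderiv f) z / poly f z))\<^sup>2
           \<le> real (degree f) * Re (poly (pderiv f) z / poly f z) \<and>
         (0 < degree f \<longrightarrow> 0 < Re (poly (pderiv f) z / poly f z))"
  using assms(1)
proof (induction "degree f" arbitrary: f)
  case 0
  then have "pderiv f = 0" by (simp add: pderiv_eq_0_iff)
  then show ?case using 0 by simp
next
  case (Suc n)
  have "\<not> constant (poly f)" using Suc.hyps(2) by (simp add: constant_degree)
  then obtain a where a: "poly f a = 0" using fundamental_theorem_of_algebra by blast
  then obtain g where g: "f = [:-a, 1:] * g" by (auto simp: poly_eq_0_iff_dvd elim: dvdE)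
  have g0: "g \<noteq> 0" using g Suc.hyps(2) by auto
  have dg: "degree f = Suc (degree g)"
    using g0 unfolding g by (subst degree_mult_eq) auto
  have gnz: "poly g w \<noteq> 0" if "0 < Re w" for w
    using Suc.prems[OF that] unfolding g by auto
  have IH: "Re z * (cmod (poly (pderiv g) z / poly g z))\<^sup>2
           \<le> real (degree g) * Re (poly (pderiv g) z / poly g z)"
         "0 < degree g \<Longrightarrow> 0 < Re (poly (pderiv g) z / poly g z)"
    using Suc.hyps(1)[of g] gnz dg Suc.hyps(2) by auto
  have Re_a: "Re a \<le> 0" using Suc.prems a by force
  have za: "z - a \<noteq> 0" using Re_a z by auto
  define u where "u = 1 / (z - a)"
  define U where "U = poly (pderiv g) z / poly g z"
  have "pderiv f = [:-a, 1:] * pderiv g + g"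
    unfolding g pderiv_mult by (simp add: pderiv_pCons)
  then have num: "poly (pderiv f) z = (z - a) * poly (pderiv g) z + poly g z"
    by (simp only: poly_add poly_mult) simp
  have den: "poly f z = (z - a) * poly g z"
    unfolding g by (simp add: algebra_simps)
  have eq: "poly (pderiv f) z / poly f z = U + u"
    unfolding num den U_def u_def using za gnz[OF z] by (simp add: add_divide_distrib)
  have cu: "(cmod u)\<^sup>2 = 1 / (cmod (z - a))\<^sup>2"
    by (simp add: u_def norm_divide power_divide)
  have Ru: "Re u = Re (z - a) / (cmod (z - a))\<^sup>2"
    by (simp add: u_def Re_divide cmod_power2)
  have cpos: "0 < (cmod (z - a))\<^sup>2" using za by simp
  have u_disc: "Re z * (cmod u)\<^sup>2 \<le> Re u"
    unfolding cu Ru using Re_a cpos by (simp add: divide_right_mono)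
  have u_pos: "0 < Re u"
    unfolding Ru using Re_a z cpos by (intro divide_pos_pos) auto
  have U0: "degree g = 0 \<longrightarrow> U = 0"
    by (simp add: U_def pderiv_eq_0_iff[THEN iffD2])
  have "Re z * (cmod (U + u))\<^sup>2 \<le> real (Suc (degree g)) * Re (U + u)"
    using IH(1) u_disc z U0 unfolding U_def[symmetric] by (intro disc_condition_add) auto
  moreover have "0 < Re (U + u)"
    using u_pos IH(2) U0 unfolding U_def[symmetric] by (cases "degree g = 0") auto
  ultimately show ?case unfolding eq dg by simp
qed

lemma poly_sum_monom:
  fixes c :: "nat \<Rightarrow> complex"
  shows "poly (\<Sum>i\<le>n. monom (c i) i) z = (\<Sum>i\<le>n. c i * z ^ i)"
  by (simp add: poly_sum poly_monom)

lemma poly_pderiv_sum_monom: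
  fixes c :: "nat \<Rightarrow> complex"
  shows "poly (pderiv (\<Sum>i\<le>Suc n. monom (c i) i)) z = (\<Sum>i\<le>n. of_nat (Suc i) * c (Suc i) * z ^ i)"
  by (induction n)
     (simp_all add: pderiv_monom pderiv_add poly_monom monom_0 pderiv_pCons del: of_nat_Suc)

lemma coeff_sum_monom: "coeff (\<Sum>i\<le>n. monom (c i) i) k = (if k \<le> n then c k else 0)"
  by (simp add: coeff_sum)

lemma gauss_lucas_half_plane:
  fixes c :: "nat \<Rightarrow> complex"
  assumes nz: "\<And>z. 0 < Re z \<Longrightarrow> (\<Sum>i\<le>Suc n. c i * z ^ i) \<noteq> 0"
    and top: "c (Suc n) \<noteq> 0" and z: "0 < Re z"
  shows "(\<Sum>i\<le>n. of_nat (Suc i) * c (Suc i) * z ^ i) \<noteq> 0"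
proof -
  define f where "f = (\<Sum>i\<le>Suc n. monom (c i) i)"
  have "coeff f (Suc n) \<noteq> 0" unfolding f_def coeff_sum_monom using top by simp
  then have "0 < degree f" using le_degree by fastforce
  moreover have "poly f w \<noteq> 0" if "0 < Re w" for w
    using nz[OF that] unfolding f_def poly_sum_monom .
  ultimately have "0 < Re (poly (pderiv f) z / poly f z)" using log_deriv_in_disc[OF _ z] by blast
  then have "poly (pderiv f) z \<noteq> 0" by auto
  then show ?thesis unfolding f_def poly_pderiv_sum_monom .
qed

text \<open>The sum is the polar derivative \<open>(n + 1) f - (z - \<zeta>) f'\<close>. If it
  vanished, \<open>U = f' / f\<close> would satisfy \<open>(z - \<zeta>) U = n + 1\<close>, and the
  disc condition on \<open>U\<close> would force \<open>Re \<zeta> \<le> 0\<close>.\<close>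

lemma laguerre_half_plane:
  fixes c :: "nat \<Rightarrow> complex"
  assumes nz: "\<And>z. 0 < Re z \<Longrightarrow> (\<Sum>i\<le>Suc n. c i * z ^ i) \<noteq> 0"
    and z: "0 < Re z" and zeta: "0 < Re \<zeta>"
  shows "(\<Sum>i\<le>n. (of_nat (Suc n - i) * c i + \<zeta> * of_nat (Suc i) * c (Suc i)) * z ^ i) \<noteq> 0"
proof
  assume "(\<Sum>i\<le>n. (of_nat (Suc n - i) * c i + \<zeta> * of_nat (Suc i) * c (Suc i)) * z ^ i) = 0"
  then have *: "(\<Sum>i\<le>n. of_nat (Suc n - i) * c i * z ^ i)
      + \<zeta> * (\<Sum>i\<le>n. of_nat (Suc i) * c (Suc i) * z ^ i) = 0"
    by (simp only: sum_distrib_left sum.distrib[symmetric] distrib_right mult.assoc)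
  define f where "f = (\<Sum>i\<le>Suc n. monom (c i) i)"
  have pf: "poly f w = (\<Sum>i\<le>Suc n. c i * w ^ i)" for w
    unfolding f_def poly_sum_monom ..
  have pf': "poly (pderiv f) w = (\<Sum>i\<le>n. of_nat (Suc i) * c (Suc i) * w ^ i)" for w
    unfolding f_def poly_pderiv_sum_monom ..
  have fnz: "poly f w \<noteq> 0" if "0 < Re w" for w
    using nz[OF that] unfolding pf .
  have deg: "degree f \<le> Suc n"
    unfolding f_def by (intro degree_sum_le) (auto intro: order.trans[OF degree_monom_le])
  have "z * poly (pderiv f) z = (\<Sum>i\<le>Suc n. of_nat i * c i * z ^ i)"
    unfolding pf' by (subst sum.atMost_Suc_shift) (simp add: sum_distrib_left mult_ac del: of_nat_Suc)
  then have "of_nat (Suc n) * poly f z - z * poly (pderiv f) z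
      = (\<Sum>i\<le>Suc n. of_nat (Suc n - i) * c i * z ^ i)"
    unfolding pf sum_distrib_left
    by (simp only: sum_subtractf[symmetric])
       (rule sum.cong, auto simp: of_nat_diff algebra_simps)
  then have eq: "of_nat (Suc n) * poly f z = (z - \<zeta>) * poly (pderiv f) z"
    using * unfolding pf' by (simp add: algebra_simps add_eq_0_iff)
  define U where "U = poly (pderiv f) z / poly f z"
  have eqU: "of_nat (Suc n) = (z - \<zeta>) * U"
    using eq fnz[OF z] by (simp add: U_def field_simps)
  have U0: "U \<noteq> 0" using eqU by (metis mult_zero_right of_nat_eq_0_iff nat.distinct(2))
  have disc: "Re z * (cmod U)\<^sup>2 \<le> real (degree f) * Re U"
    using log_deriv_in_disc[OF fnz z] unfolding U_def by blast
  \<comment> \<open>The coefficient \<open>c (Suc n)\<close> may be zero, so \<open>degree f\<close>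
    may be smaller than \<open>Suc n\<close>; replacing it by \<open>Suc n\<close> in the disc
    condition uses the sign of \<open>Re U\<close>.\<close>
  then have "0 \<le> real (degree f) * Re U" using z by (smt (verit) zero_le_mult_iff zero_le_power2)
  then have "0 \<le> Re U \<or> degree f = 0" by (auto simp: zero_le_mult_iff)
  then have "real (degree f) * Re U \<le> real (Suc n) * Re U"
  proof
    assume "0 \<le> Re U"
    then show ?thesis using deg by (intro mult_right_mono) auto
  next
    assume "degree f = 0"
    then have "U = 0" by (simp add: U_def pderiv_eq_0_iff[THEN iffD2])
    then show ?thesis using U0 by simp
  qed
  with disc have "Re z * (cmod U)\<^sup>2 \<le> real (Suc n) * Re U" by simp
  also have "\<dots> = Re (of_nat (Suc n) * cnj U)" by simp
  also have "\<dots> = Re ((z - \<zeta>) * (U * cnj U))" unfolding eqU by (simp only: mult.assoc)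
  also have "\<dots> = Re (z - \<zeta>) * (cmod U)\<^sup>2"
    by (simp add: complex_mult_cnj cmod_power2 del: of_real_add of_real_power)
  finally have "Re z \<le> Re (z - \<zeta>)" using U0 by simp
  then show False using zeta by simp
qed

section \<open>Leading coefficients of polynomials without zeros in right half planes\<close>

text \<open>The negated ratio is the sum of the zeros, all of real part at most 0. Instead of
  factoring, the induction differentiates down to degree one: by Gauss-Lucas the hypothesis
  survives, and the ratio is only scaled by a positive real.\<close>

lemma Re_top_coeff_ratio_nonneg:
  fixes c :: "nat \<Rightarrow> complex"
  assumes "\<And>z. 0 < Re z \<Longrightarrow> (\<Sum>i\<le>Suc n. c i * z ^ i) \<noteq> 0" and "c (Suc n) \<noteq> 0"
  shows "0 \<le> Re (c n / c (Suc n))"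
  using assms
proof (induction n arbitrary: c)
  case 0
  show ?case
  proof (rule ccontr)
    assume "\<not> 0 \<le> Re (c 0 / c (Suc 0))"
    then have "0 < Re (- (c 0 / c (Suc 0)))" by simp
    from "0.prems"(1)[OF this] "0.prems"(2) show False by simp
  qed
next
  case (Suc n)
  have "0 \<le> Re ((of_nat (Suc n) * c (Suc n)) / (of_nat (Suc (Suc n)) * c (Suc (Suc n))))"
  proof (rule Suc.IH[of "\<lambda>i. of_nat (Suc i) * c (Suc i)"])
    fix z :: complex assume "0 < Re z"
    then show "(\<Sum>i\<le>Suc n. of_nat (Suc i) * c (Suc i) * z ^ i) \<noteq> 0"
      using gauss_lucas_half_plane[OF Suc.prems] by blast
  qed (use Suc.prems(2) in \<open>simp del: of_nat_Suc\<close>)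
  also have "(of_nat (Suc n) * c (Suc n)) / (of_nat (Suc (Suc n)) * c (Suc (Suc n)))
      = of_real (real (Suc n) / real (Suc (Suc n))) * (c (Suc n) / c (Suc (Suc n)))"
    by simp
  also have "Re \<dots> = (real (Suc n) / real (Suc (Suc n))) * Re (c (Suc n) / c (Suc (Suc n)))"
    by (simp only: times_complex.simps Re_complex_of_real Im_complex_of_real)
  finally have "0 \<le> (real (Suc n) / real (Suc (Suc n))) * Re (c (Suc n) / c (Suc (Suc n)))" .
  moreover have "0 < real (Suc n) / real (Suc (Suc n))" by simp
  ultimately show ?case by (simp only: zero_le_mult_iff) linarith
qed

text \<open>Divided by \<open>v ^ n\<close>, the polynomial tends to \<open>c n\<close> as
  \<open>v\<close> goes to infinity through the positive integers, uniformly on compact sets of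
  \<open>y\<close>. Hurwitz's theorem then passes the absence of zeros to the limit.\<close>

lemma top_coeff_nonzero_half_plane:
  fixes c :: "nat \<Rightarrow> complex poly"
  assumes nz: "\<And>y v. 0 < Re y \<Longrightarrow> 0 < Re v \<Longrightarrow> (\<Sum>j\<le>n. poly (c j) y * v ^ j) \<noteq> 0"
    and top: "c n \<noteq> 0" and y: "0 < Re y"
  shows "poly (c n) y \<noteq> 0"
proof -
  define S where "S = {y. 0 < Re y}"
  define s where "s = (\<lambda>m. inverse (of_nat (Suc m)) :: complex)"
  have s0: "s \<longlonglongrightarrow> 0" unfolding s_def by (intro LIMSEQ_Suc lim_inverse_n)
  have "open S" unfolding S_def by (rule open_halfspace_Re_gt)
  have "convex S" unfolding S_def by (rule convex_halfspace_Re_gt)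
  then have "connected S" by (rule convex_connected)
  \<comment> \<open>Here \<open>s m\<close> is \<open>1 / v\<close>; the induction is Horner's
    scheme in \<open>s m\<close>.\<close>
  have lim: "uniform_limit K (\<lambda>m y. \<Sum>j\<le>n. poly (c j) y * s m ^ (n - j)) (poly (c n)) sequentially"
    if K: "compact K" for K
  proof (induction n)
    case 0
    show ?case by (simp add: uniform_limit_const)
  next
    case (Suc n)
    have bdd: "bounded (poly p ` K)" for p :: "complex poly"
      using K by (intro compact_imp_bounded compact_continuous_image continuous_intros)
    have "uniform_limit K (\<lambda>m y. s m) (\<lambda>y. 0) sequentially"
      using s0 by (auto simp: uniform_limit_iff tendsto_iff elim: eventually_mono)
    then have "uniform_limit K (\<lambda>m y. s m * (\<Sum>j\<le>n. poly (c j) y * s m ^ (n - j)) + poly (c (Suc n)) y)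
        (\<lambda>y. 0 * poly (c n) y + poly (c (Suc n)) y) sequentially"
      by (intro uniform_limit_add uniform_lim_mult uniform_limit_const Suc.IH bdd)
         (auto simp: bounded_iff)
    moreover have "s m * (\<Sum>j\<le>n. poly (c j) y * s m ^ (n - j)) + poly (c (Suc n)) y
        = (\<Sum>j\<le>Suc n. poly (c j) y * s m ^ (Suc n - j))" for m y
      by (simp add: sum_distrib_left Suc_diff_le mult_ac)
    ultimately show ?case by simp
  qed
  have nz': "(\<Sum>j\<le>n. poly (c j) y * s m ^ (n - j)) \<noteq> 0" if "y \<in> S" for y m
  proof -
    have "(\<Sum>j\<le>n. poly (c j) y * s m ^ (n - j))
        = s m ^ n * (\<Sum>j\<le>n. poly (c j) y * of_nat (Suc m) ^ j)"
      unfolding sum_distrib_left s_def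
      by (intro sum.cong) (auto simp: power_diff field_simps simp del: of_nat_Suc)
    moreover have "s m \<noteq> 0" by (simp add: s_def del: of_nat_Suc)
    moreover have "(\<Sum>j\<le>n. poly (c j) y * of_nat (Suc m) ^ j) \<noteq> 0"
      using that by (intro nz) (auto simp: S_def)
    ultimately show ?thesis by simp
  qed
  show ?thesis
  \<comment> \<open>Hurwitz's theorem requires a nonconstant limit; a constant one could only have a
    zero by vanishing on the infinite set \<open>S\<close>, against \<open>top\<close>.\<close>
  proof (cases "poly (c n) constant_on S")
    case False
    show ?thesis
      by (rule Hurwitz_no_zeros[OF \<open>open S\<close> \<open>connected S\<close> _ _ lim False nz'])
         (use y in \<open>auto simp: S_def intro!: holomorphic_intros\<close>)
  next
    case True
    show ?thesis
    proof
      assume "poly (c n) y = 0"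
      with True y have "poly (c n) w = 0" if "w \<in> S" for w
        using that unfolding constant_on_def S_def by auto
      then have "S \<subseteq> {w. poly (c n) w = 0}" by blast
      then have "finite S" using poly_roots_finite[OF top] finite_subset by blast
      moreover have "infinite S"
        using \<open>open S\<close> y finite_imp_not_open[of S] by (auto simp: S_def)
      ultimately show False by blast
    qed
  qed
qed

text \<open>The point \<open>- \<gamma> / \<delta>\<close> is the zero of
  \<open>\<gamma> + \<delta> y\<close>, the leading coefficient in \<open>v\<close>, so it cannot
  lie in the open half plane.\<close>

lemma Re_bilinear_coeff_ratio_nonneg:
  fixes \<alpha> \<beta> \<gamma> \<delta> :: complex
  assumes nz: "\<And>y v. 0 < Re y \<Longrightarrow> 0 < Re v \<Longrightarrow> \<alpha> + \<beta> * y + \<gamma> * v + \<delta> * y * v \<noteq> 0"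
    and \<delta>: "\<delta> \<noteq> 0"
  shows "0 \<le> Re (\<gamma> / \<delta>)"
proof (rule ccontr)
  assume "\<not> 0 \<le> Re (\<gamma> / \<delta>)"
  then have "0 < Re (- (\<gamma> / \<delta>))" by simp
  moreover define c where "c = (\<lambda>j::nat. if j = 0 then [:\<alpha>, \<beta>:] else [:\<gamma>, \<delta>:])"
  have "(\<Sum>j\<le>1. poly (c j) y * v ^ j) \<noteq> 0" if "0 < Re y" "0 < Re v" for y v
    using nz[OF that] by (simp add: c_def algebra_simps)
  moreover have "c 1 \<noteq> 0" using \<delta> by (simp add: c_def)
  ultimately have "poly (c 1) (- (\<gamma> / \<delta>)) \<noteq> 0"
    using top_coeff_nonzero_half_plane[of c 1] by blast
  then show False using \<delta> by (simp add: c_def)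
qed

lemma bivariate_top_coeff_nonzero:
  fixes k :: "nat \<Rightarrow> nat \<Rightarrow> complex"
  assumes nz: "\<And>y v. 0 < Re y \<Longrightarrow> 0 < Re v \<Longrightarrow> (\<Sum>i\<le>n. \<Sum>j\<le>n. k i j * y ^ i * v ^ j) \<noteq> 0"
    and top: "k n n \<noteq> 0" and y: "0 < Re y"
  shows "(\<Sum>i\<le>n. k i n * y ^ i) \<noteq> 0"
proof -
  define c where "c = (\<lambda>j. \<Sum>i\<le>n. monom (k i j) i)"
  have pc: "poly (c j) y = (\<Sum>i\<le>n. k i j * y ^ i)" for j y
    unfolding c_def poly_sum_monom ..
  have "(\<Sum>j\<le>n. poly (c j) y * v ^ j) \<noteq> 0" if "0 < Re y" "0 < Re v" for y v
    using nz[OF that] unfolding pc sum_distrib_right by (subst sum.swap)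
  moreover have "coeff (c n) n \<noteq> 0" using top unfolding c_def coeff_sum_monom by simp
  then have "c n \<noteq> 0" by auto
  ultimately show ?thesis using top_coeff_nonzero_half_plane[of c n, OF _ _ y] unfolding pc by blast
qed

section \<open>Contraction of a bivariate polynomial by one degree in each variable\<close>

text \<open>Polarizing \<open>\<Sum> k i j y\<^sup>i v\<^sup>j\<close> once in \<open>y\<close> and once in \<open>v\<close> gives, up to the factor
  \<open>(n + 1)\<^sup>2\<close>, a bilinear \<open>\<alpha> + \<beta> y' + \<gamma> v' + \<delta> y' v'\<close> whose coefficients are polynomials of
  degree \<open>n\<close> in \<open>y\<close> and \<open>v\<close>; the contraction is \<open>\<beta> + \<gamma> + w \<delta>\<close>.\<close>

definition contract :: "nat \<Rightarrow> complex \<Rightarrow> (nat \<Rightarrow> nat \<Rightarrow> complex) \<Rightarrow> nat \<Rightarrow> nat \<Rightarrow> complex" where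
  "contract n w k i j =
     of_nat (Suc i) * of_nat (Suc n - j) * k (Suc i) j
     + of_nat (Suc n - i) * of_nat (Suc j) * k i (Suc j)
     + w * of_nat (Suc i) * of_nat (Suc j) * k (Suc i) (Suc j)"

text \<open>The two conclusions restore both hypotheses at degree \<open>n\<close>, which lets an
  induction iterate the contraction. Each reduces to a nonzero factor times a sum of ratios with
  nonnegative real part and a positive multiple of \<open>w\<close>.\<close>

lemma contract_nonzero:
  fixes k :: "nat \<Rightarrow> nat \<Rightarrow> complex"
  assumes nz: "\<And>y v. 0 < Re y \<Longrightarrow> 0 < Re v \<Longrightarrow>
      (\<Sum>i\<le>Suc n. \<Sum>j\<le>Suc n. k i j * y ^ i * v ^ j) \<noteq> 0"
    and top: "k (Suc n) (Suc n) \<noteq> 0" and w: "0 < Re w"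
  shows "contract n w k n n \<noteq> 0"
    and "\<And>y v. 0 < Re y \<Longrightarrow> 0 < Re v \<Longrightarrow>
      (\<Sum>i\<le>n. \<Sum>j\<le>n. contract n w k i j * y ^ i * v ^ j) \<noteq> 0"
proof -
  have nz_swap: "(\<Sum>i\<le>Suc n. \<Sum>j\<le>Suc n. k j i * v ^ i * y ^ j) \<noteq> 0"
    if "0 < Re y" "0 < Re v" for y v
    using nz[OF that] by (subst sum.swap) (simp only: mult_ac not_False_eq_True)
  have top_v: "(\<Sum>i\<le>Suc n. k i (Suc n) * y ^ i) \<noteq> 0" if "0 < Re y" for y
    by (rule bivariate_top_coeff_nonzero[of k "Suc n", OF nz top that])
  have top_y: "(\<Sum>j\<le>Suc n. k (Suc n) j * v ^ j) \<noteq> 0" if "0 < Re v" for v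
    by (rule bivariate_top_coeff_nonzero[of "\<lambda>i j. k j i" "Suc n", OF nz_swap top that])
  have nz_v: "(\<Sum>j\<le>Suc n. (\<Sum>i\<le>Suc n. k i j * y ^ i) * v ^ j) \<noteq> 0"
    if "0 < Re y" "0 < Re v" for y v
    using nz[OF that] unfolding sum_distrib_right by (subst sum.swap)

  show "contract n w k n n \<noteq> 0"
  proof
    assume 0: "contract n w k n n = 0"
    define s where "s = k (Suc n) n / k (Suc n) (Suc n) + k n (Suc n) / k (Suc n) (Suc n)"
    have "0 \<le> Re (k n (Suc n) / k (Suc n) (Suc n))"
      by (rule Re_top_coeff_ratio_nonneg[of "\<lambda>i. k i (Suc n)" n]) (use top_v top in auto)
    moreover have "0 \<le> Re (k (Suc n) n / k (Suc n) (Suc n))"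
      by (rule Re_top_coeff_ratio_nonneg[of "k (Suc n)" n]) (use top_y top in auto)
    ultimately have s: "0 \<le> Re s" by (simp add: s_def)
    have "contract n w k n n = of_nat (Suc n) * k (Suc n) (Suc n) * (s + of_nat (Suc n) * w)"
      using top by (simp add: contract_def s_def field_simps)
    then have "s + of_nat (Suc n) * w = 0" using 0 top by (simp del: of_nat_Suc)
    then have "Re s + real (Suc n) * Re w = 0" by (simp add: complex_eq_iff)
    moreover have "0 < real (Suc n) * Re w" using w by simp
    ultimately show False using s by simp
  qed

  fix y v :: complex assume y: "0 < Re y" and v: "0 < Re v"
  let ?S = "\<lambda>f. \<Sum>i\<le>n. \<Sum>j\<le>n. f i j * y ^ i * v ^ j"
  define \<alpha> where "\<alpha> = ?S (\<lambda>i j. of_nat (Suc n - i) * of_nat (Suc n - j) * k i j)"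
  define \<beta> where "\<beta> = ?S (\<lambda>i j. of_nat (Suc i) * of_nat (Suc n - j) * k (Suc i) j)"
  define \<gamma> where "\<gamma> = ?S (\<lambda>i j. of_nat (Suc n - i) * of_nat (Suc j) * k i (Suc j))"
  define \<delta> where "\<delta> = ?S (\<lambda>i j. of_nat (Suc i) * of_nat (Suc j) * k (Suc i) (Suc j))"

  \<comment> \<open>Laguerre's theorem is used twice: in \<open>v\<close> with pole
    \<open>v1\<close>, which produces the coefficients \<open>e i\<close> of a polynomial in
    \<open>y\<close>, then in \<open>y\<close> with pole \<open>y1\<close>.\<close>
  have bilinear: "\<alpha> + \<beta> * y1 + \<gamma> * v1 + \<delta> * y1 * v1 \<noteq> 0"
    if y1: "0 < Re y1" and v1: "0 < Re v1" for y1 v1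
  proof -
    define e where
      "e = (\<lambda>i. \<Sum>j\<le>n. (of_nat (Suc n - j) * k i j + v1 * of_nat (Suc j) * k i (Suc j)) * v ^ j)"
    have "(\<Sum>i\<le>Suc n. e i * y ^ i) \<noteq> 0" if y: "0 < Re y" for y
    proof -
      have "(\<Sum>i\<le>Suc n. e i * y ^ i) =
          (\<Sum>j\<le>n. \<Sum>i\<le>Suc n.
             (of_nat (Suc n - j) * k i j + v1 * of_nat (Suc j) * k i (Suc j)) * v ^ j * y ^ i)"
        unfolding e_def sum_distrib_right by (rule sum.swap)
      also have "\<dots> = (\<Sum>j\<le>n. (of_nat (Suc n - j) * (\<Sum>i\<le>Suc n. k i j * y ^ i)
          + v1 * of_nat (Suc j) * (\<Sum>i\<le>Suc n. k i (Suc j) * y ^ i)) * v ^ j)"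
        unfolding sum_distrib_left sum.distrib[symmetric] sum_distrib_right
        by (intro sum.cong refl) (simp only: distrib_left distrib_right mult_ac)
      also have "\<dots> \<noteq> 0"
        by (rule laguerre_half_plane[of "\<lambda>j. \<Sum>i\<le>Suc n. k i j * y ^ i" n, OF nz_v[OF y] v v1])
      finally show ?thesis .
    qed
    then have "(\<Sum>i\<le>n. (of_nat (Suc n - i) * e i + y1 * of_nat (Suc i) * e (Suc i)) * y ^ i) \<noteq> 0"
      by (rule laguerre_half_plane[OF _ y y1])
    also have "(\<Sum>i\<le>n. (of_nat (Suc n - i) * e i + y1 * of_nat (Suc i) * e (Suc i)) * y ^ i)
        = \<alpha> + \<beta> * y1 + \<gamma> * v1 + \<delta> * y1 * v1"
      unfolding \<alpha>_def \<beta>_def \<gamma>_def \<delta>_def e_def sum_distrib_left sum_distrib_right sum.distrib[symmetric]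
      by (intro sum.cong refl) (simp only: distrib_left distrib_right mult_ac add_ac)
    finally show ?thesis .
  qed

  \<comment> \<open>The number \<open>\<delta>\<close> is the mixed partial derivative at
    \<open>(y, v)\<close>, so Gauss-Lucas is applied once in each variable; \<open>top_v\<close> and
    \<open>top\<close> supply the leading coefficients in \<open>v\<close>.\<close>
  have "\<delta> \<noteq> 0"
  proof -
    define e where "e = (\<lambda>i. \<Sum>j\<le>n. of_nat (Suc j) * k i (Suc j) * v ^ j)"
    have "(\<Sum>i\<le>Suc n. e i * y ^ i) \<noteq> 0" if y: "0 < Re y" for y
    proof -
      have "(\<Sum>i\<le>Suc n. e i * y ^ i) =
          (\<Sum>j\<le>n. \<Sum>i\<le>Suc n. of_nat (Suc j) * k i (Suc j) * v ^ j * y ^ i)"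
        unfolding e_def sum_distrib_right by (rule sum.swap)
      also have "\<dots> = (\<Sum>j\<le>n. of_nat (Suc j) * (\<Sum>i\<le>Suc n. k i (Suc j) * y ^ i) * v ^ j)"
        unfolding sum_distrib_left sum_distrib_right
        by (intro sum.cong refl) (simp only: mult_ac)
      also have "\<dots> \<noteq> 0"
        by (rule gauss_lucas_half_plane[of "\<lambda>j. \<Sum>i\<le>Suc n. k i j * y ^ i" n,
              OF nz_v[OF y] top_v[OF y] v])
      finally show ?thesis .
    qed
    moreover have "e (Suc n) \<noteq> 0"
      unfolding e_def by (rule gauss_lucas_half_plane[of "k (Suc n)" n, OF top_y top v])
    ultimately have "(\<Sum>i\<le>n. of_nat (Suc i) * e (Suc i) * y ^ i) \<noteq> 0"
      by (rule gauss_lucas_half_plane[OF _ _ y])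
    also have "(\<Sum>i\<le>n. of_nat (Suc i) * e (Suc i) * y ^ i) = \<delta>"
      unfolding \<delta>_def e_def sum_distrib_left sum_distrib_right
      by (intro sum.cong refl) (simp only: mult_ac)
    finally show ?thesis .
  qed
  moreover have "0 \<le> Re (\<gamma> / \<delta>)"
    by (rule Re_bilinear_coeff_ratio_nonneg[OF bilinear \<open>\<delta> \<noteq> 0\<close>])
  moreover have "0 \<le> Re (\<beta> / \<delta>)"
  proof (rule Re_bilinear_coeff_ratio_nonneg[of \<alpha> \<gamma> \<beta> \<delta>])
    fix y v :: complex assume "0 < Re y" "0 < Re v"
    then show "\<alpha> + \<gamma> * y + \<beta> * v + \<delta> * y * v \<noteq> 0"
      using bilinear[of v y] by (simp add: algebra_simps)
  qed fact
  ultimately have "0 < Re (\<beta> / \<delta> + \<gamma> / \<delta> + w)" using w by simp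
  then have "\<beta> / \<delta> + \<gamma> / \<delta> + w \<noteq> 0" by (metis less_irrefl zero_complex.sel(1))
  moreover have "\<beta> + \<gamma> + w * \<delta> = \<delta> * (\<beta> / \<delta> + \<gamma> / \<delta> + w)"
    using \<open>\<delta> \<noteq> 0\<close> by (simp add: field_simps)
  ultimately have "\<beta> + \<gamma> + w * \<delta> \<noteq> 0" using \<open>\<delta> \<noteq> 0\<close> by simp
  also have "\<beta> + \<gamma> + w * \<delta> = ?S (contract n w k)"
    unfolding \<beta>_def \<gamma>_def \<delta>_def contract_def sum_distrib_left sum.distrib[symmetric]
    by (intro sum.cong refl) (simp only: distrib_left distrib_right mult_ac add_ac)
  finally show "?S (contract n w k) \<noteq> 0" .
qed

section \<open>Weights of the iterated contraction\<close>

text \<open>At \<open>(d - i, d - j)\<close> with \<open>i + j \<le> d\<close> this is the unsquared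
  factor of the theorem times \<open>w ^ (d - i - j)\<close>. The guard keeps truncated subtraction
  from giving a nonzero value when \<open>i + j < d\<close>.\<close>

definition conv_weight :: "nat \<Rightarrow> complex \<Rightarrow> nat \<Rightarrow> nat \<Rightarrow> complex" where
  "conv_weight d w i j =
     (if d \<le> i + j then fact i * fact j / (fact d * fact (i + j - d)) * w ^ (i + j - d) else 0)"

text \<open>This is the transpose of \<open>contract\<close>. Away from the boundary cases all
  weights are multiples of one term \<open>X\<close>, and the identity becomes
  \<open>(n - a) + (n - b) + m = n + 1\<close>.\<close>

lemma conv_weight_rec:
  assumes ij: "i \<le> Suc n" "j \<le> Suc n"
  shows "of_nat (Suc n) ^ 2 * conv_weight (Suc n) w i j =
     of_nat i * of_nat (Suc n - j) * conv_weight n w (i - 1) j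
     + of_nat (Suc n - i) * of_nat j * conv_weight n w i (j - 1)
     + w * of_nat i * of_nat j * conv_weight n w (i - 1) (j - 1)" (is "?L = ?R")
proof (cases "i + j < Suc n \<or> i = 0 \<or> j = 0")
  case True
  then consider "i + j < Suc n" | "i = 0" "j = Suc n" | "i = Suc n" "j = 0"
    using ij by linarith
  then show ?thesis
  proof cases
    case 1
    then show ?thesis by (cases i; cases j) (auto simp: conv_weight_def)
  qed (auto simp: conv_weight_def power2_eq_square)
next
  case False
  then obtain a b where ab: "i = Suc a" "j = Suc b" by (meson not0_implies_Suc)
  \<comment> \<open>The number \<open>m\<close> is the exponent \<open>i + j - Suc n\<close> of
    \<open>w\<close> on the left-hand side.\<close>
  obtain m where m: "a + b + 1 = n + m"
    using False ab by (metis add_Suc add_Suc_right not_less Suc_le_mono le_Suc_ex Suc_eq_plus1)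
  define X where "X = fact a * fact b / (fact n * fact m) * w ^ m"
  have "a \<le> n" "b \<le> n" using ij ab by auto
  have "conv_weight (Suc n) w i j * of_nat (Suc n) = of_nat (Suc a) * of_nat (Suc b) * X"
  proof -
    have "i + j - Suc n = m" "Suc n \<le> i + j" using m ab by auto
    then show ?thesis by (simp add: conv_weight_def X_def ab field_simps del: of_nat_Suc)
  qed
  then have L: "?L = of_nat (Suc n) * of_nat (Suc a) * of_nat (Suc b) * X"
    by (simp add: power2_eq_square mult_ac del: of_nat_Suc)
  have 1: "conv_weight n w (i - 1) j = of_nat (Suc b) * X"
  proof -
    have "i - 1 + j - n = m" "n \<le> i - 1 + j" using m ab by auto
    then show ?thesis by (simp add: conv_weight_def X_def ab field_simps del: of_nat_Suc)
  qed
  have 2: "conv_weight n w i (j - 1) = of_nat (Suc a) * X"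
  proof -
    have "i + (j - 1) - n = m" "n \<le> i + (j - 1)" using m ab by auto
    then show ?thesis by (simp add: conv_weight_def X_def ab field_simps del: of_nat_Suc)
  qed
  have 3: "w * conv_weight n w (i - 1) (j - 1) = of_nat m * X"
  proof (cases m)
    case 0
    then show ?thesis using m ab by (simp add: conv_weight_def)
  next
    case (Suc m')
    then have "a + b - n = m'" "n \<le> a + b" using m by auto
    then show ?thesis by (simp add: conv_weight_def X_def ab Suc field_simps del: of_nat_Suc)
  qed
  have "?R = (of_nat (n - b) + of_nat (n - a) + of_nat m) * of_nat (Suc a) * of_nat (Suc b) * X"
  proof -
    have "?R = of_nat (Suc a) * of_nat (n - b) * conv_weight n w (i - 1) j
       + of_nat (n - a) * of_nat (Suc b) * conv_weight n w i (j - 1)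
       + of_nat (Suc a) * of_nat (Suc b) * (w * conv_weight n w (i - 1) (j - 1))"
      by (simp only: ab mult_ac diff_Suc_Suc)
    then show ?thesis unfolding 1 2 3 by (simp only: distrib_left distrib_right mult_ac)
  qed
  also have "of_nat (n - b) + of_nat (n - a) + of_nat m = (of_nat (Suc n) :: complex)"
  proof -
    have "n - b + (n - a) + m = Suc n" using m \<open>a \<le> n\<close> \<open>b \<le> n\<close> by linarith
    then show ?thesis by (metis of_nat_add)
  qed
  finally show ?thesis unfolding L ..
qed

lemma sum_conv_weight_contract:
  "of_nat (Suc n) ^ 2 * (\<Sum>i\<le>Suc n. \<Sum>j\<le>Suc n. conv_weight (Suc n) w i j * k i j)
     = (\<Sum>i\<le>n. \<Sum>j\<le>n. conv_weight n w i j * contract n w k i j)"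
proof -
  \<comment> \<open>Summation by parts: the terms missing at index \<open>0\<close> or
    \<open>Suc n\<close> vanish because of the factors \<open>of_nat i\<close>,
    \<open>of_nat j\<close> and \<open>of_nat (Suc n - i)\<close>,
    \<open>of_nat (Suc n - j)\<close>.\<close>
  have shift: "(\<Sum>i\<le>n. f (Suc i)) = (\<Sum>i\<le>Suc n. f i)" if "f 0 = 0" for f :: "nat \<Rightarrow> complex"
    using that by (subst sum.atMost_Suc_shift) simp
  let ?T1 = "\<lambda>i j. of_nat i * of_nat (Suc n - j) * conv_weight n w (i - 1) j * k i j"
  let ?T2 = "\<lambda>i j. of_nat (Suc n - i) * of_nat j * conv_weight n w i (j - 1) * k i j"
  let ?T3 = "\<lambda>i j. w * of_nat i * of_nat j * conv_weight n w (i - 1) (j - 1) * k i j"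
  have T1: "(\<Sum>i\<le>n. \<Sum>j\<le>n. ?T1 (Suc i) j) = (\<Sum>i\<le>Suc n. \<Sum>j\<le>Suc n. ?T1 i j)"
  proof -
    have "(\<Sum>i\<le>n. \<Sum>j\<le>n. ?T1 (Suc i) j) = (\<Sum>i\<le>n. \<Sum>j\<le>Suc n. ?T1 (Suc i) j)"
      by simp
    also have "\<dots> = (\<Sum>i\<le>Suc n. \<Sum>j\<le>Suc n. ?T1 i j)"
      by (rule shift[of "\<lambda>i. \<Sum>j\<le>Suc n. ?T1 i j"]) simp
    finally show ?thesis .
  qed
  have T2: "(\<Sum>i\<le>n. \<Sum>j\<le>n. ?T2 i (Suc j)) = (\<Sum>i\<le>Suc n. \<Sum>j\<le>Suc n. ?T2 i j)"
  proof -
    have "(\<Sum>i\<le>n. \<Sum>j\<le>n. ?T2 i (Suc j)) = (\<Sum>i\<le>n. \<Sum>j\<le>Suc n. ?T2 i j)"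
      by (intro sum.cong refl shift) simp
    then show ?thesis by simp
  qed
  have T3: "(\<Sum>i\<le>n. \<Sum>j\<le>n. ?T3 (Suc i) (Suc j)) = (\<Sum>i\<le>Suc n. \<Sum>j\<le>Suc n. ?T3 i j)"
  proof -
    have "(\<Sum>i\<le>n. \<Sum>j\<le>n. ?T3 (Suc i) (Suc j)) = (\<Sum>i\<le>n. \<Sum>j\<le>Suc n. ?T3 (Suc i) j)"
      by (intro sum.cong refl shift) simp
    also have "\<dots> = (\<Sum>i\<le>Suc n. \<Sum>j\<le>Suc n. ?T3 i j)"
      by (rule shift[of "\<lambda>i. \<Sum>j\<le>Suc n. ?T3 i j"]) simp
    finally show ?thesis .
  qed
  have "(\<Sum>i\<le>n. \<Sum>j\<le>n. conv_weight n w i j * contract n w k i j)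
      = (\<Sum>i\<le>n. \<Sum>j\<le>n. ?T1 (Suc i) j) + (\<Sum>i\<le>n. \<Sum>j\<le>n. ?T2 i (Suc j))
        + (\<Sum>i\<le>n. \<Sum>j\<le>n. ?T3 (Suc i) (Suc j))"
    unfolding sum.distrib[symmetric] contract_def diff_Suc_1
    by (intro sum.cong refl) (simp only: distrib_left mult_ac)
  also have "\<dots> = (\<Sum>i\<le>Suc n. \<Sum>j\<le>Suc n. ?T1 i j + ?T2 i j + ?T3 i j)"
    unfolding T1 T2 T3 sum.distrib ..
  also have "\<dots> = (\<Sum>i\<le>Suc n. \<Sum>j\<le>Suc n. of_nat (Suc n) ^ 2 * conv_weight (Suc n) w i j * k i j)"
    by (intro sum.cong refl) (simp only: conv_weight_rec distrib_right atMost_iff)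
  finally show ?thesis by (simp only: sum_distrib_left mult.assoc)
qed

text \<open>Contracting lowers the degree by one, keeps both hypotheses, and changes the weighted
  sum only by the factor \<open>(n + 1)^2\<close>.\<close>

lemma sum_conv_weight_nonzero:
  fixes k :: "nat \<Rightarrow> nat \<Rightarrow> complex"
  assumes "\<And>y v. 0 < Re y \<Longrightarrow> 0 < Re v \<Longrightarrow> (\<Sum>i\<le>d. \<Sum>j\<le>d. k i j * y ^ i * v ^ j) \<noteq> 0"
    and "k d d \<noteq> 0" and w: "0 < Re w"
  shows "(\<Sum>i\<le>d. \<Sum>j\<le>d. conv_weight d w i j * k i j) \<noteq> 0"
  using assms(1,2)
proof (induction d arbitrary: k)
  case 0
  then show ?case by (simp add: conv_weight_def)
next
  case (Suc n)
  have "(\<Sum>i\<le>n. \<Sum>j\<le>n. conv_weight n w i j * contract n w k i j) \<noteq> 0"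
    using contract_nonzero[OF Suc.prems w] by (intro Suc.IH)
  then show ?case unfolding sum_conv_weight_contract[symmetric] by auto
qed

section \<open>Application to the squared weights\<close>

text \<open>The arguments of \<open>x\<close> and \<open>y\<close> lie strictly between -pi/2 and
  pi/2, so their sum never reaches pi or -pi.\<close>

lemma half_plane_mult_not_nonpos:
  assumes "0 < Re x" "0 < Re y"
  shows "\<not> (x * y \<in> \<real> \<and> Re (x * y) \<le> 0)"
proof
  assume "x * y \<in> \<real> \<and> Re (x * y) \<le> 0"
  then have im: "Re x * Im y + Im x * Re y = 0" and re: "Re x * Re y \<le> Im x * Im y"
    by (auto simp: complex_is_Real_iff)
  have "Im y = - (Im x * Re y / Re x)" using im assms by (simp add: field_simps)
  then have "Im x * Im y = - ((Im x)\<^sup>2 * Re y / Re x)" by (simp add: power2_eq_square)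
  also have "\<dots> \<le> 0" using assms by simp
  finally show False using re mult_pos_pos[OF assms] by linarith
qed

lemma only_nonpos_real_roots_half_plane_mult:
  assumes "only_nonpos_real_roots p" "degree p = d" "0 < Re x" "0 < Re y"
  shows "(\<Sum>i\<le>d. of_real (coeff p i) * x ^ i * y ^ i) \<noteq> 0"
proof -
  have "poly (map_poly complex_of_real p) (x * y) \<noteq> 0"
    using assms half_plane_mult_not_nonpos unfolding only_nonpos_real_roots_def by blast
  also have "poly (map_poly complex_of_real p) (x * y)
      = (\<Sum>i\<le>d. of_real (coeff p i) * x ^ i * y ^ i)"
    using assms(2)
    by (simp add: poly_altdef coeff_map_poly degree_map_poly power_mult_distrib mult_ac)
  finally show ?thesis .
qed

text \<open>The inner contraction, with parameter \<open>x\<close>, acts on \<open>y, v\<close>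
  while \<open>Y, V\<close> stay fixed inside the coefficients; the outer one, with parameter
  \<open>w\<close>, then acts on \<open>Y, V\<close>.\<close>

lemma rectangular_convolution_nonzero:
  fixes A B :: "nat \<Rightarrow> complex"
  assumes A: "\<And>x y. 0 < Re x \<Longrightarrow> 0 < Re y \<Longrightarrow> (\<Sum>i\<le>d. A i * x ^ i * y ^ i) \<noteq> 0"
    and B: "\<And>x y. 0 < Re x \<Longrightarrow> 0 < Re y \<Longrightarrow> (\<Sum>i\<le>d. B i * x ^ i * y ^ i) \<noteq> 0"
    and top: "A d \<noteq> 0" "B d \<noteq> 0" and x: "0 < Re x" and w: "0 < Re w"
  shows "(\<Sum>i\<le>d. \<Sum>j\<le>d. conv_weight d w i j * (conv_weight d x i j * (A i * B j))) \<noteq> 0"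
proof (rule sum_conv_weight_nonzero[of "\<lambda>i j. conv_weight d x i j * (A i * B j)" d, OF _ _ w])
  fix Y V :: complex assume Y: "0 < Re Y" and V: "0 < Re V"
  have "(\<Sum>i\<le>d. \<Sum>j\<le>d. conv_weight d x i j * (A i * Y ^ i * (B j * V ^ j))) \<noteq> 0"
  proof (rule sum_conv_weight_nonzero[of "\<lambda>i j. A i * Y ^ i * (B j * V ^ j)" d, OF _ _ x])
    fix y v :: complex assume y: "0 < Re y" and v: "0 < Re v"
    have "(\<Sum>i\<le>d. \<Sum>j\<le>d. A i * Y ^ i * (B j * V ^ j) * y ^ i * v ^ j)
        = (\<Sum>i\<le>d. A i * Y ^ i * y ^ i) * (\<Sum>j\<le>d. B j * V ^ j * v ^ j)"
      unfolding sum_product by (intro sum.cong refl) (simp only: mult_ac)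
    then show "(\<Sum>i\<le>d. \<Sum>j\<le>d. A i * Y ^ i * (B j * V ^ j) * y ^ i * v ^ j) \<noteq> 0"
      using A[OF Y y] B[OF V v] by simp
  qed (use top Y V in auto)
  then show "(\<Sum>i\<le>d. \<Sum>j\<le>d. conv_weight d x i j * (A i * B j) * Y ^ i * V ^ j) \<noteq> 0"
    by (simp only: mult_ac not_False_eq_True)
\<comment> \<open>The outer leading coefficient is \<open>x ^ d * A d * B d\<close>.\<close>
qed (use top x in \<open>auto simp: conv_weight_def\<close>)

theorem theorem3p1:
  fixes d :: nat and a b :: "nat \<Rightarrow> real" and p q r :: "real poly"
  assumes p: "p = (\<Sum>i=0..d. monom (a i) (d - i))"
    and q: "q = (\<Sum>i=0..d. monom (b i) (d - i))"
    and "degree p = d" and "lead_coeff p > 0" and "only_nonpos_real_roots p"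
    and "degree q = d" and "lead_coeff q > 0" and "only_nonpos_real_roots q"
    and r: "r = (\<Sum>k=0..d. monom
              (\<Sum>(i, j) | i + j = k.
                 ((fact (d - i) * fact (d - j)) / (fact d * fact (d - i - j)))\<^sup>2 * a i * b j)
              (d - k))"
  shows "degree r = d \<and> lead_coeff r > 0 \<and> only_nonpos_real_roots r"
proof -
  have coeff_rev: "coeff (\<Sum>i=0..d. monom (c i) (d - i)) k = (if k \<le> d then c (d - k) else 0)"
    for c :: "nat \<Rightarrow> real" and k
  proof -
    have "coeff (\<Sum>i=0..d. monom (c i) (d - i)) k = (\<Sum>i=0..d. if d - i = k then c i else 0)"
      by (simp add: coeff_sum)
    also have "\<dots> = (\<Sum>i=0..d. if i = d - k then if k \<le> d then c i else 0 else 0)"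
      by (intro sum.cong) auto
    finally show ?thesis by (simp add: sum.delta)
  qed
  define t where "t = (\<lambda>i j.
    ((fact (d - i) * fact (d - j)) / (fact d * fact (d - i - j)))\<^sup>2 * a i * b j)"
  define \<rho> where "\<rho> = (\<lambda>k. \<Sum>(i, j) | i + j = k. t i j)"
  have r': "r = (\<Sum>k=0..d. monom (\<rho> k) (d - k))"
    unfolding r \<rho>_def t_def ..
  have a0: "0 < a 0" and b0: "0 < b 0"
    using assms(3,4,6,7) coeff_rev[of _ d] unfolding p q by auto
  have "{(i, j). i + j = (0::nat)} = {(0, 0)}" by auto
  then have "\<rho> 0 = a 0 * b 0" unfolding \<rho>_def t_def by simp
  then have "0 < coeff r d" unfolding r' coeff_rev using a0 b0 by simp
  moreover have "degree r \<le> d"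
    unfolding r' by (intro degree_sum_le) (auto intro: order.trans[OF degree_monom_le])
  ultimately have deg_r: "degree r = d" using le_degree[of r d] by fastforce

  \<comment> \<open>Both parameters may be taken equal, since every point off the nonpositive real
    axis is the square of a point of the open right half plane.\<close>
  have nz: "poly (map_poly complex_of_real r) (x * x) \<noteq> 0" if x: "0 < Re x" for x
  proof -
    have rev: "(\<Sum>i\<le>d. f i) = (\<Sum>i\<le>d. f (d - i))" for f :: "nat \<Rightarrow> complex"
      using sum.atLeastAtMost_rev[of f 0 d] by (simp add: atMost_atLeast0)
    let ?u = "\<lambda>i j. conv_weight d x i j * (conv_weight d x i j *
      (complex_of_real (coeff p i) * complex_of_real (coeff q j)))"
    have "(\<Sum>i\<le>d. \<Sum>j\<le>d. ?u i j) \<noteq> 0"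
      using assms(3-8)
      by (intro rectangular_convolution_nonzero only_nonpos_real_roots_half_plane_mult x) auto
    also have "(\<Sum>i\<le>d. \<Sum>j\<le>d. ?u i j) = (\<Sum>i\<le>d. \<Sum>j\<le>d. ?u (d - i) (d - j))"
      by (rule trans[OF rev]) (intro sum.cong refl rev)
    also have "\<dots> = (\<Sum>(i, j)\<in>{..d} \<times> {..d}. ?u (d - i) (d - j))"
      by (simp add: sum.cartesian_product)
    \<comment> \<open>After the index reversal the guard of \<open>conv_weight\<close> reads
      \<open>i + j \<le> d\<close>, so the other pairs contribute zero.\<close>
    also have "\<dots> = (\<Sum>(i, j) | i + j \<le> d. of_real (t i j) * (x * x) ^ (d - (i + j)))"
    proof (rule sum.mono_neutral_cong_right)
      show "\<forall>ij \<in> {..d} \<times> {..d} - {(i, j). i + j \<le> d}. (case ij of (i, j) \<Rightarrow> ?u (d - i) (d - j)) = 0"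
        by (auto simp: conv_weight_def split: if_splits)
      fix ij assume "ij \<in> {(i, j). i + j \<le> d}"
      then obtain i j where ij: "ij = (i, j)" "i + j \<le> d" by auto
      then have "conv_weight d x (d - i) (d - j) =
          of_real (fact (d - i) * fact (d - j) / (fact d * fact (d - i - j))) * x ^ (d - (i + j))"
        by (simp add: conv_weight_def)
      moreover have "coeff p (d - i) = a i" "coeff q (d - j) = b j"
        using ij unfolding p q coeff_rev by auto
      ultimately show "(case ij of (i, j) \<Rightarrow> ?u (d - i) (d - j)) =
          (case ij of (i, j) \<Rightarrow> of_real (t i j) * (x * x) ^ (d - (i + j)))"
        by (simp add: ij t_def power2_eq_square power_mult_distrib mult_ac)
    qed auto
    also have "{(i, j). i + j \<le> d} = (\<Union>k\<in>{0..d}. {(i, j). i + j = k})" by auto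
    also have "(\<Sum>(i, j)\<in>\<dots>. of_real (t i j) * (x * x) ^ (d - (i + j)))
        = (\<Sum>k=0..d. \<Sum>(i, j) | i + j = k. of_real (t i j) * (x * x) ^ (d - (i + j)))"
    proof (rule sum.UNION_disjoint)
      show "\<forall>k\<in>{0..d}. finite {(i, j). i + j = k}"
      proof
        fix k :: nat
        show "finite {(i, j). i + j = k}"
          by (rule finite_subset[of _ "{..k} \<times> {..k}"]) auto
      qed
    qed auto
    also have "\<dots> = (\<Sum>k=0..d. of_real (\<rho> k) * (x * x) ^ (d - k))"
      unfolding \<rho>_def of_real_sum sum_distrib_right by (intro sum.cong refl) auto
    also have "\<dots> = (\<Sum>k\<le>d. of_real (coeff r k) * (x * x) ^ k)"
      unfolding r' coeff_rev unfolding atMost_atLeast0[symmetric]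
      by (rule trans[OF rev]) (auto intro!: sum.cong)
    also have "\<dots> = poly (map_poly complex_of_real r) (x * x)"
      by (subst poly_altdef) (simp add: degree_map_poly deg_r coeff_map_poly)
    finally show ?thesis .
  qed
  have "z \<in> \<real> \<and> Re z \<le> 0" if "poly (map_poly complex_of_real r) z = 0" for z
  proof (rule ccontr)
    assume "\<not> (z \<in> \<real> \<and> Re z \<le> 0)"
    \<comment> \<open>The principal square root has \<open>Re s \<ge> 0\<close>, and
      \<open>Re s = 0\<close> would make its square real and nonpositive.\<close>
    moreover obtain s where s: "s\<^sup>2 = z" "0 \<le> Re s" using power2_csqrt Re_csqrt by blast
    moreover have "s\<^sup>2 \<in> \<real> \<and> Re (s\<^sup>2) \<le> 0" if "Re s = 0"
      using that by (simp add: complex_is_Real_iff Re_power2 Im_power2)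
    ultimately have "0 < Re s" by force
    from nz[OF this] that s(1) show False by (simp only: power2_eq_square)
  qed
  then show ?thesis
    using \<open>0 < coeff r d\<close> deg_r unfolding only_nonpos_real_roots_def by simp
qed

end
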